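(* We have $e_{S,m} \leqslant m^{-(2-o(1))m}$, $e_{E,m} \leqslant m^{-(2-o(1))m}$ and $e_{O,m} \leqslant m^{-(3-o(1))m}$ as $m\to\infty$; that is, for every $\varepsilon>0$ there exists $m_0=m_0(\varepsilon)$ such that for all integers $m\geqslant m_0$, $e_{S,m}\leqslant m^{-(2-\varepsilon)m}$, $e_{E,m}\leqslant m^{-(2-\varepsilon)m}$ and $e_{O,m}\leqslant m^{-(3-\varepsilon)m}$.
   Context: For a positive integer $n$ and $j\geqslant1$, $\omega_j(n)$ is the number of primes $p$ with $p^j\,\|\,n$ (primes dividing $n$ with multiplicity exactly $j$). Put $\omega_S(n)=\sum_{j\geqslant2}\omega_j(n)$, $\omega_E(n)=\sum_{j\geqslant2,\ j\text{ even}}\omega_j(n)$, $\omega_O(n)=\sum_{j\geqslant3,\ j\text{ odd}}\omega_j(n)$. For integers $m\geqslant 0$, $e_{S,m}$, $e_{E,m}$, $e_{O,m}$ are the natural densities of the positive integers $n$ with $\omega_S(n)=m$, $\omega_E(n)=m$, $\omega_O(n)=m$ respectively, e.g. $e_{S,m}=\lim_{x\to\infty}\frac1x\#\{n\leqslant x:\omega_S(n)=m\}$ (these limits exist). *)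

theory Defs
  imports "HOL-Analysis.Analysis" "HOL-Computational_Algebra.Computational_Algebra"
begin

definition omega_exact :: "nat \<Rightarrow> nat \<Rightarrow> nat" where
  "omega_exact j n = card {p. prime p \<and> multiplicity p n = j}"

text \<open>
  For \<open>n > 0\<close> the sums below have only finitely many nonzero terms, so that
  \<^const>\<open>infsum\<close> (over \<open>nat\<close> with the discrete topology) is the ordinary finite sum.
\<close>

definition omega_S :: "nat \<Rightarrow> nat" where
  "omega_S n = (\<Sum>\<^sub>\<infinity>j\<in>{j. j \<ge> 2}. omega_exact j n)"

definition omega_E :: "nat \<Rightarrow> nat" where
  "omega_E n = (\<Sum>\<^sub>\<infinity>j\<in>{j. j \<ge> 2 \<and> even j}. omega_exact j n)"

definition omega_O :: "nat \<Rightarrow> nat" where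
  "omega_O n = (\<Sum>\<^sub>\<infinity>j\<in>{j. j \<ge> 3 \<and> odd j}. omega_exact j n)"

text \<open>
  \<^const>\<open>Lim\<close> is a definite description: the value is meaningful only for sets of positive
  integers whose density exists.
\<close>

definition natural_density :: "nat set \<Rightarrow> real" where
  "natural_density A = Lim at_top (\<lambda>x::real. real (card {n \<in> A. 0 < n \<and> real n \<le> x}) / x)"

definition e_S :: "nat \<Rightarrow> real" where
  "e_S m = natural_density {n. 0 < n \<and> omega_S n = m}"

definition e_E :: "nat \<Rightarrow> real" where
  "e_E m = natural_density {n. 0 < n \<and> omega_E n = m}"

definition e_O :: "nat \<Rightarrow> real" where
  "e_O m = natural_density {n. 0 < n \<and> omega_O n = m}"

end

theory Submission
  imports Defs
begin

text \<open>
  All three functions \<open>\<omega>\<^sub>S\<close>, \<open>\<omega>\<^sub>E\<close>, \<open>\<omega>\<^sub>O\<close> count the primes whose multiplicity in \<open>n\<close> lies in a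
  fixed set \<open>J\<close> of exponents, all at least \<open>s\<close>, where \<open>s = 2\<close> in the first two cases and \<open>s = 3\<close>
  in the last. For such a \<open>J\<close> the density of the \<open>n\<close> with exactly \<open>m\<close> of these primes is bounded by
  \<open>m\<close> to the power \<open>-(s - o(1)) m\<close> (\<open>natural_density_omega_in_le\<close>).

  The bound. If \<open>n\<close> has \<open>m\<close> primes with multiplicity at least \<open>s\<close>, it is divisible by the \<open>s\<close>-th
  power of their product. A union bound over the possible sets \<open>A\<close> of primes therefore bounds the
  density by the \<open>m\<close>-th elementary symmetric sum of the numbers \<open>k\<close> to the power \<open>-s\<close>, and here \<open>k\<close>
  may as well run over all positive integers. Split \<open>s = a + b\<close> with \<open>b = 1 + \<delta>\<close>. The product of \<open>m\<close>
  distinct positive integers is at least \<open>m!\<close>, so the exponent \<open>a\<close> contributes a factor of at most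
  \<open>m!\<close> to the power \<open>-a\<close>. The exponent \<open>b\<close> leaves a convergent series with sum \<open>Z\<close>, whose \<open>m\<close>-th
  symmetric sum is at most \<open>exp (m Z)\<close> divided by \<open>m ^ m\<close>. Since \<open>m!\<close> is at least \<open>m ^ m\<close> divided
  by \<open>exp m\<close>, the exponents of \<open>m\<close> add up to \<open>-(a + 1) m = -(s - \<delta>) m\<close>, and the factors
  exponential in \<open>m\<close> cost another \<open>\<delta> m\<close> at most once \<open>m\<close> is large.

  Existence. A bound on the counting functions bounds the density only if the limit exists.
  Ignoring all primes above \<open>y\<close> and all exponents from \<open>2 y\<close> on turns the condition on \<open>n\<close>
  into a periodic one, whose density clearly exists. The integers at which the condition changes are
  divisible by \<open>d\<^sup>2\<close> for some \<open>d > y\<close>, so their proportion is at most \<open>1 / y\<close>, uniformly in the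
  range. Hence the proportions form a Cauchy sequence (\<open>convergent_density_if_approx\<close>).
\<close>

section \<open>Counting multiples up to a bound\<close>

definition count_upto :: "nat set \<Rightarrow> nat \<Rightarrow> nat" where
  "count_upto A N = card (A \<inter> {0<..N})"

lemma count_upto_Suc: "count_upto A (Suc N) = count_upto A N + (if Suc N \<in> A then 1 else 0)"
proof -
  have "A \<inter> {0<..Suc N} = (if Suc N \<in> A then insert (Suc N) (A \<inter> {0<..N}) else A \<inter> {0<..N})"
    by (auto simp: le_Suc_eq)
  then show ?thesis
    by (simp add: count_upto_def)
qed

lemma count_upto_0 [simp]: "count_upto A 0 = 0"
  by (simp add: count_upto_def)

lemma count_upto_multiples_le:
  assumes "0 < d"
  shows "real (count_upto {n. d dvd n} N) \<le> real N / real d"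
proof -
  have "{n. d dvd n} \<inter> {0<..N} \<subseteq> (\<lambda>k. d * k) ` {0<..N div d}"
  proof
    fix n assume "n \<in> {n. d dvd n} \<inter> {0<..N}"
    then obtain k where k: "n = d * k" "0 < n" "n \<le> N" by auto
    then have "k \<le> N div d" using assms
      by (metis div_le_mono nonzero_mult_div_cancel_left not_gr_zero)
    then show "n \<in> (\<lambda>k. d * k) ` {0<..N div d}" using k by auto
  qed
  then have "count_upto {n. d dvd n} N \<le> card ((\<lambda>k. d * k) ` {0<..N div d})"
    unfolding count_upto_def by (intro card_mono) auto
  also have "\<dots> \<le> N div d"
    using card_image_le[of "{0<..N div d}" "\<lambda>k. d * k"] by simp
  finally have "real (count_upto {n. d dvd n} N) \<le> real (N div d)" by simp
  also have "\<dots> \<le> real N / real d" by (simp add: of_nat_div_le_of_nat)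
  finally show ?thesis .
qed

lemma count_upto_UN_multiples_le:
  assumes "finite I" and "\<And>i. i \<in> I \<Longrightarrow> 0 < d i"
    and "A \<inter> {0<..N} \<subseteq> (\<Union>i\<in>I. {n. d i dvd n})"
  shows "real (count_upto A N) \<le> real N * (\<Sum>i\<in>I. 1 / real (d i))"
proof -
  have "count_upto A N \<le> card (\<Union>i\<in>I. {n. d i dvd n} \<inter> {0<..N})"
    unfolding count_upto_def using assms by (intro card_mono) auto
  also have "\<dots> \<le> (\<Sum>i\<in>I. count_upto {n. d i dvd n} N)"
    unfolding count_upto_def by (intro card_UN_le assms)
  finally have "real (count_upto A N) \<le> (\<Sum>i\<in>I. real (count_upto {n. d i dvd n} N))"
    by (metis of_nat_le_iff of_nat_sum)
  also have "\<dots> \<le> (\<Sum>i\<in>I. real N / real (d i))"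
    by (intro sum_mono count_upto_multiples_le assms)
  finally show ?thesis by (simp add: sum_distrib_left)
qed

section \<open>Existence of densities\<close>

text \<open>
  Limits along the integers suffice: the counting function at a real \<open>x\<close> is the one at \<open>\<lfloor>x\<rfloor>\<close>, and
  \<open>\<lfloor>x\<rfloor> / x\<close> tends to 1.
\<close>

lemma natural_density_eqI:
  assumes "(\<lambda>N. real (count_upto A N) / real N) \<longlonglongrightarrow> d"
  shows "natural_density A = d"
proof -
  let ?f = "\<lambda>x::real. nat \<lfloor>x\<rfloor>"
  have f: "filterlim ?f sequentially at_top"
    by (intro filterlim_compose[OF filterlim_nat_sequentially filterlim_floor_sequentially])
  have "((\<lambda>x::real. real (nat \<lfloor>x\<rfloor>) / x) \<longlongrightarrow> 1) at_top"
  proof (rule tendsto_sandwich)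
    show "\<forall>\<^sub>F x::real in at_top. (x - 1) / x \<le> real (nat \<lfloor>x\<rfloor>) / x"
      using eventually_gt_at_top[of 0]
      by eventually_elim (intro divide_right_mono, linarith+)
    show "\<forall>\<^sub>F x::real in at_top. real (nat \<lfloor>x\<rfloor>) / x \<le> 1"
      using eventually_gt_at_top[of 0] by eventually_elim (simp add: field_simps)
    have "((\<lambda>x::real. 1 - 1 / x) \<longlongrightarrow> 1 - 0) at_top"
      by (intro tendsto_intros tendsto_divide_0[OF tendsto_const] filterlim_at_top_imp_at_infinity
            filterlim_ident)
    then show "((\<lambda>x::real. (x - 1) / x) \<longlongrightarrow> 1) at_top"
      by (rule filterlim_cong[THEN iffD1, rotated -1])
        (auto intro: eventually_mono[OF eventually_gt_at_top[of 0]] simp: field_simps)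
  qed simp
  from tendsto_mult[OF filterlim_compose[OF assms f] this]
  have "((\<lambda>x. real (count_upto A (?f x)) / real (?f x) * (real (?f x) / x)) \<longlongrightarrow> d) at_top"
    by simp
  then have "((\<lambda>x. real (card {n \<in> A. 0 < n \<and> real n \<le> x}) / x) \<longlongrightarrow> d) at_top"
  proof (rule filterlim_cong[THEN iffD1, rotated -1, OF _ refl refl])
    show "\<forall>\<^sub>F x::real in at_top. real (count_upto A (?f x)) / real (?f x) * (real (?f x) / x)
        = real (card {n \<in> A. 0 < n \<and> real n \<le> x}) / x"
      using eventually_ge_at_top[of 1]
    proof eventually_elim
      case (elim x)
      have "{n \<in> A. 0 < n \<and> real n \<le> x} = A \<inter> {0<..?f x}"
        using elim by (auto simp: le_nat_floor) linarith
      then show ?case using elim by (simp add: count_upto_def)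
    qed
  qed
  then show ?thesis
    unfolding natural_density_def by (intro tendsto_Lim) auto
qed

lemma bounded_if_periodic:
  fixes g :: "nat \<Rightarrow> real"
  assumes "0 < Q" and "\<And>N. g (N + Q) = g N"
  shows "\<bar>g N\<bar> \<le> (\<Sum>i<Q. \<bar>g i\<bar>)"
proof -
  have "g (r + k * Q) = g r" for r k
  proof (induction k)
    case (Suc k)
    then show ?case using assms(2)[of "r + k * Q"] by (simp add: algebra_simps)
  qed simp
  from this[of "N mod Q" "N div Q"] have "g N = g (N mod Q)" by simp
  then show ?thesis
    using assms(1) member_le_sum[of "N mod Q" "{..<Q}" "\<lambda>i. \<bar>g i\<bar>"] by simp
qed

text \<open>
  With \<open>r\<close> elements of \<open>B\<close> per period, the counting function minus its linear trend
  \<open>N r / Q\<close> is itself periodic, hence bounded.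
\<close>

lemma periodic_convergent_density:
  assumes "0 < Q" and per: "\<And>n. n + Q \<in> B \<longleftrightarrow> n \<in> B"
  shows "convergent (\<lambda>N. real (count_upto B N) / real N)"
proof -
  define r where "r = count_upto B Q"
  define g where "g N = real (count_upto B N) - real N * (real r / real Q)" for N
  have "count_upto B (N + Q) = count_upto B N + r" for N
  proof (induction N)
    case (Suc N)
    have "Suc N + Q \<in> B \<longleftrightarrow> Suc N \<in> B" by (rule per)
    then show ?case using Suc by (simp add: count_upto_Suc)
  qed (simp add: r_def)
  then have "g (N + Q) = g N" for N
    using assms(1) by (simp add: g_def field_simps)
  then have bd: "\<bar>g N\<bar> \<le> (\<Sum>i<Q. \<bar>g i\<bar>)" for N
    by (rule bounded_if_periodic[OF assms(1)])
  have "(\<lambda>N. g N / real N) \<longlonglongrightarrow> 0"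
  proof (rule Lim_null_comparison)
    show "\<forall>\<^sub>F N in sequentially. norm (g N / real N) \<le> (\<Sum>i<Q. \<bar>g i\<bar>) / real N"
      using bd by (auto simp: divide_right_mono)
    show "(\<lambda>N. (\<Sum>i<Q. \<bar>g i\<bar>) / real N) \<longlonglongrightarrow> 0"
      by (rule lim_const_over_n)
  qed
  then have "(\<lambda>N. g N / real N + real r / real Q) \<longlonglongrightarrow> 0 + real r / real Q"
    by (intro tendsto_intros)
  then have "(\<lambda>N. real (count_upto B N) / real N) \<longlonglongrightarrow> 0 + real r / real Q"
    by (rule filterlim_cong[THEN iffD1, rotated -1, OF _ refl refl])
      (auto intro!: eventually_mono[OF eventually_gt_at_top[of 0]] simp: g_def field_simps)
  then show ?thesis by (rule convergentI)
qed

text \<open>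
  Comparison with the telescoping sum of \<open>1 / (d - 1) - 1 / d\<close>. A bound linear in \<open>1 / y\<close> is what
  makes the exceptional sets below small.
\<close>

lemma sum_inverse_squares_tail_le:
  assumes "0 < y"
  shows "(\<Sum>d\<in>{y<..N}. 1 / real (d\<^sup>2)) \<le> 1 / real y"
proof (cases "y \<le> N")
  case True
  then have "(\<Sum>d\<in>{y<..N}. 1 / real (d\<^sup>2)) \<le> 1 / real y - 1 / real N"
  proof (induction N rule: dec_induct)
    case (step N)
    have "{y<..Suc N} = insert (Suc N) {y<..N}" using step by auto
    moreover have "1 / real ((Suc N)\<^sup>2) \<le> 1 / real N - 1 / real (Suc N)"
    proof -
      have "0 < N" using step assms by simp
      then have "1 / real N - 1 / real (Suc N) = 1 / (real N * real (Suc N))"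
        by (simp add: field_simps)
      moreover have "1 / real ((Suc N)\<^sup>2) \<le> 1 / (real N * real (Suc N))"
        using \<open>0 < N\<close> by (intro frac_le mult_pos_pos) (auto simp: power2_eq_square algebra_simps)
      ultimately show ?thesis by simp
    qed
    ultimately show ?case using step.IH by simp
  qed simp
  also have "\<dots> \<le> 1 / real y" by simp
  finally show ?thesis .
qed (use assms in auto)

lemma count_upto_square_multiples_le:
  assumes "0 < y"
  shows "real (count_upto {n. \<exists>d>y. d\<^sup>2 dvd n} N) \<le> real N / real y"
proof -
  have le_N: "d \<le> N" if "d\<^sup>2 dvd n" "0 < n" "n \<le> N" for d n :: nat
    using dvd_imp_le[OF that(1,2)] that(3) self_le_power[of d 2] by (cases "d = 0") auto
  have "real (count_upto {n. \<exists>d>y. d\<^sup>2 dvd n} N)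
      \<le> real N * (\<Sum>d\<in>{y<..N}. 1 / real (d\<^sup>2))"
  proof (rule count_upto_UN_multiples_le)
    show "{n. \<exists>d>y. d\<^sup>2 dvd n} \<inter> {0<..N} \<subseteq> (\<Union>d\<in>{y<..N}. {n. d\<^sup>2 dvd n})"
    proof
      fix n assume "n \<in> {n. \<exists>d>y. d\<^sup>2 dvd n} \<inter> {0<..N}"
      then obtain d where "y < d" "d\<^sup>2 dvd n" "0 < n" "n \<le> N" by auto
      with le_N[of d n] show "n \<in> (\<Union>d\<in>{y<..N}. {n. d\<^sup>2 dvd n})" by auto
    qed
  qed (use assms in auto)
  also have "\<dots> \<le> real N * (1 / real y)"
    by (intro mult_left_mono sum_inverse_squares_tail_le assms) auto
  finally show ?thesis by simp
qed

lemma count_upto_diff_le: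
  assumes "\<And>n. 0 < n \<Longrightarrow> n \<notin> E \<Longrightarrow> n \<in> A \<longleftrightarrow> n \<in> B"
  shows "\<bar>real (count_upto A N) - real (count_upto B N)\<bar> \<le> real (count_upto E N)"
proof -
  have "count_upto X N \<le> count_upto Y N + count_upto E N"
    if "\<And>n. 0 < n \<Longrightarrow> n \<notin> E \<Longrightarrow> n \<in> X \<longleftrightarrow> n \<in> Y" for X Y
  proof -
    have "X \<inter> {0<..N} \<subseteq> (Y \<inter> {0<..N}) \<union> (E \<inter> {0<..N})"
      using that by auto
    then have "card (X \<inter> {0<..N}) \<le> card ((Y \<inter> {0<..N}) \<union> (E \<inter> {0<..N}))"
      by (intro card_mono) auto
    also note card_Un_le
    finally show ?thesis by (simp add: count_upto_def)
  qed
  from this[of A B] this[of B A] show ?thesis using assms by (auto simp: abs_le_iff)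
qed

text \<open>
  The error of the approximation is at most \<open>1 / y\<close> for every \<open>N\<close>, not only in the limit; this
  uniformity transfers the Cauchy property from \<open>B\<close> to \<open>A\<close>.
\<close>

lemma convergent_density_if_approx:
  assumes approx: "\<And>y. 0 < y \<Longrightarrow> \<exists>B. convergent (\<lambda>N. real (count_upto B N) / real N) \<and>
    (\<forall>n>0. (\<forall>d>y. \<not> d\<^sup>2 dvd n) \<longrightarrow> (n \<in> A \<longleftrightarrow> n \<in> B))"
  shows "convergent (\<lambda>N. real (count_upto A N) / real N)"
proof -
  have "Cauchy (\<lambda>N. real (count_upto A N) / real N)"
  proof (rule metric_CauchyI)
    fix e :: real assume "0 < e"
    then obtain k where "inverse (real (Suc k)) < e / 3"
      using reals_Archimedean[of "e / 3"] by auto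
    then obtain y :: nat where y: "0 < y" "1 / real y < e / 3"
      by (metis inverse_eq_divide zero_less_Suc)
    obtain B where B: "convergent (\<lambda>N. real (count_upto B N) / real N)"
      and AB: "\<And>n. 0 < n \<Longrightarrow> (\<forall>d>y. \<not> d\<^sup>2 dvd n) \<Longrightarrow> n \<in> A \<longleftrightarrow> n \<in> B"
      using approx[OF y(1)] by blast
    have near: "dist (real (count_upto A N) / real N) (real (count_upto B N) / real N) < e / 3" for N
    proof -
      have "\<bar>real (count_upto A N) - real (count_upto B N)\<bar>
          \<le> real (count_upto {n. \<exists>d>y. d\<^sup>2 dvd n} N)"
        using AB by (intro count_upto_diff_le) auto
      also have "\<dots> \<le> real N / real y"
        by (rule count_upto_square_multiples_le[OF y(1)])
      finally have "\<bar>real (count_upto A N) - real (count_upto B N)\<bar> / real N \<le> 1 / real y"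
        using y(1) by (cases "N = 0") (auto simp: field_simps)
      moreover have "dist (real (count_upto A N) / real N) (real (count_upto B N) / real N)
          = \<bar>real (count_upto A N) - real (count_upto B N)\<bar> / real N"
        by (simp add: dist_real_def flip: diff_divide_distrib)
      ultimately show ?thesis using y(2) by linarith
    qed
    from B have "Cauchy (\<lambda>N. real (count_upto B N) / real N)"
      by (simp add: Cauchy_convergent_iff)
    then obtain M where M: "\<And>i j. M \<le> i \<Longrightarrow> M \<le> j \<Longrightarrow>
        dist (real (count_upto B i) / real i) (real (count_upto B j) / real j) < e / 3"
      using \<open>0 < e\<close> unfolding Cauchy_def by (metis divide_pos_pos zero_less_numeral)
    show "\<exists>M. \<forall>i\<ge>M. \<forall>j\<ge>M.
        dist (real (count_upto A i) / real i) (real (count_upto A j) / real j) < e"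
    proof (intro exI allI impI)
      fix i j assume "M \<le> i" "M \<le> j"
      from M[OF this] near[of i] near[of j]
      show "dist (real (count_upto A i) / real i) (real (count_upto A j) / real j) < e"
        unfolding dist_real_def by linarith
    qed
  qed
  then show ?thesis by (simp add: Cauchy_convergent_iff)
qed

section \<open>Primes with multiplicity in a prescribed set\<close>

definition omega_in :: "nat set \<Rightarrow> nat \<Rightarrow> nat" where
  "omega_in J n = card {p. prime p \<and> multiplicity p n \<in> J}"

lemma multiplicity_prime_eq_iff:
  fixes n p :: nat
  assumes "prime p" "0 < n"
  shows "multiplicity p n = j \<longleftrightarrow> p ^ j dvd n \<and> \<not> p ^ Suc j dvd n"
proof -
  have "\<not> is_unit p" "n \<noteq> 0" using assms by (auto simp: prime_nat_iff)
  then show ?thesis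
    by (metis multiplicity_dvd multiplicity_eqI not_dvd_imp_multiplicity_0 power_dvd_iff_le_multiplicity
         not_less_eq_eq order_refl)
qed

lemma less_prime_power:
  fixes p k :: nat
  assumes "prime p"
  shows "k < p ^ k"
  using less_exp[of k] power_mono[of 2 p k] prime_ge_2_nat[OF assms] by linarith

lemma prime_multiplicity_le:
  fixes n p :: nat
  assumes "prime p" "0 < n"
  shows "multiplicity p n \<le> n"
proof -
  have "p ^ multiplicity p n \<le> n"
    using assms by (intro dvd_imp_le multiplicity_dvd) auto
  then show ?thesis using less_prime_power[OF assms(1), of "multiplicity p n"] by linarith
qed

lemma prime_dvd_if_multiplicity:
  fixes n p :: nat
  assumes "0 \<notin> J" "multiplicity p n \<in> J"
  shows "p dvd n"
  using assms not_dvd_imp_multiplicity_0 by metis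

lemma finite_primes_multiplicity:
  fixes n :: nat
  assumes "0 < n" "0 \<notin> J"
  shows "finite {p. prime p \<and> multiplicity p n \<in> J}"
proof (rule finite_subset)
  show "{p. prime p \<and> multiplicity p n \<in> J} \<subseteq> {..n}"
    using assms by (auto intro: dvd_imp_le dest: prime_dvd_if_multiplicity)
qed simp

text \<open>
  The sets of primes with multiplicity exactly \<open>j\<close> are disjoint for different \<open>j\<close>, and empty for
  \<open>j > n\<close>, so the infinite sum is a finite one and counts their union. The exponent 0 has to be
  excluded because infinitely many primes have it.
\<close>

lemma infsum_omega_exact:
  assumes "0 < n" "0 \<notin> J"
  shows "(\<Sum>\<^sub>\<infinity>j\<in>J. omega_exact j n) = omega_in J n"
proof -
  have "(\<Sum>\<^sub>\<infinity>j\<in>J. omega_exact j n) = (\<Sum>\<^sub>\<infinity>j\<in>J \<inter> {..n}. omega_exact j n)"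
  proof (rule infsum_cong_neutral)
    fix j assume "j \<in> J - J \<inter> {..n}"
    then have "{p. prime p \<and> multiplicity p n = j} = {}"
      using prime_multiplicity_le[OF _ assms(1)] by auto
    then show "omega_exact j n = 0" unfolding omega_exact_def by (simp only: card.empty)
  qed auto
  also have "\<dots> = (\<Sum>j\<in>J \<inter> {..n}. omega_exact j n)" by simp
  also have "\<dots> = card (\<Union>j\<in>J \<inter> {..n}. {p. prime p \<and> multiplicity p n = j})"
    unfolding omega_exact_def
  proof (rule card_UN_disjoint[symmetric])
    show "\<forall>j\<in>J \<inter> {..n}. finite {p. prime p \<and> multiplicity p n = j}"
    proof
      fix j assume "j \<in> J \<inter> {..n}"
      then show "finite {p. prime p \<and> multiplicity p n = j}"
        using finite_primes_multiplicity[of n "{j}"] assms by (auto split: if_splits)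
    qed
  qed auto
  also have "(\<Union>j\<in>J \<inter> {..n}. {p. prime p \<and> multiplicity p n = j})
      = {p. prime p \<and> multiplicity p n \<in> J}"
    using prime_multiplicity_le[OF _ assms(1)] by auto
  finally show ?thesis by (simp add: omega_in_def)
qed

text \<open>
  The truncation keeps the primes up to \<open>y\<close> and the exponents below \<open>2 y\<close>. A discarded prime
  \<open>p > y\<close> gives a divisor \<open>p\<^sup>2\<close> of \<open>n\<close>, since \<open>J\<close> has no exponent below 2; a discarded
  exponent gives a divisor \<open>(p ^ y)\<^sup>2\<close> with \<open>p ^ y > y\<close>. Both are squares of numbers above \<open>y\<close>.
\<close>

lemma omega_in_convergent_density:
  assumes J: "J \<subseteq> {2..}"
  shows "convergent (\<lambda>N. real (count_upto {n. 0 < n \<and> omega_in J n = m} N) / real N)"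
proof (rule convergent_density_if_approx)
  fix y :: nat assume y: "0 < y"
  define P where "P n = {p. prime p \<and> p \<le> y \<and>
      (\<exists>j\<in>J. j < 2 * y \<and> p ^ j dvd n \<and> \<not> p ^ Suc j dvd n)}" for n
  define B where "B = {n. card (P n) = m}"
  \<comment> \<open>Divisible by \<open>p ^ i\<close> for all \<open>p \<le> y\<close> and \<open>i \<le> 2 y\<close>, hence a period of every condition used in \<open>P\<close>.\<close>
  define Q :: nat where "Q = fact y ^ (2 * y)"
  have "P (n + Q) = P n" for n
  proof -
    have dvd_iff: "p ^ i dvd n + Q \<longleftrightarrow> p ^ i dvd n" if "prime p" "p \<le> y" "i \<le> 2 * y" for p i
    proof -
      have "p dvd fact y"
        using that prime_gt_0_nat[of p] by (intro dvd_fact) auto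
      then have "p ^ i dvd Q"
        unfolding Q_def using that(3) by (rule dvd_power_le)
      then show ?thesis by (rule dvd_add_left_iff)
    qed
    have "(p ^ j dvd n + Q \<and> \<not> p ^ Suc j dvd n + Q) \<longleftrightarrow> (p ^ j dvd n \<and> \<not> p ^ Suc j dvd n)"
      if "prime p" "p \<le> y" "j < 2 * y" for p j
      using dvd_iff[OF that(1,2), of j] dvd_iff[OF that(1,2), of "Suc j"] that(3) by linarith
    then show ?thesis unfolding P_def by blast
  qed
  then have "convergent (\<lambda>N. real (count_upto B N) / real N)"
    by (intro periodic_convergent_density[of Q]) (auto simp: B_def Q_def)
  moreover have "P n = {p. prime p \<and> multiplicity p n \<in> J}"
    if n: "0 < n" "\<forall>d>y. \<not> d\<^sup>2 dvd n" for n
  proof -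
    have "p \<le> y \<and> multiplicity p n < 2 * y" if p: "prime p" "multiplicity p n \<in> J" for p
    proof
      have "2 \<le> multiplicity p n" using J p(2) by auto
      then have "p\<^sup>2 dvd n" by (rule multiplicity_dvd')
      then show "p \<le> y" using n(2) not_le by blast
      show "multiplicity p n < 2 * y"
      proof (rule ccontr)
        assume "\<not> multiplicity p n < 2 * y"
        then have "p ^ (2 * y) dvd n" by (intro multiplicity_dvd') auto
        then have "(p ^ y)\<^sup>2 dvd n" by (simp add: power_mult[symmetric] mult.commute)
        then show False using n(2) less_prime_power[OF p(1)] by blast
      qed
    qed
    moreover have "P n = {p. prime p \<and> p \<le> y \<and> (\<exists>j\<in>J. j < 2 * y \<and> multiplicity p n = j)}"
      unfolding P_def by (simp only: multiplicity_prime_eq_iff[OF _ n(1)] cong: conj_cong)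
    ultimately show ?thesis by auto
  qed
  then have "\<forall>n>0. (\<forall>d>y. \<not> d\<^sup>2 dvd n) \<longrightarrow>
      (n \<in> {n. 0 < n \<and> omega_in J n = m} \<longleftrightarrow> n \<in> B)"
    unfolding B_def omega_in_def by simp
  ultimately show "\<exists>B. convergent (\<lambda>N. real (count_upto B N) / real N) \<and>
    (\<forall>n>0. (\<forall>d>y. \<not> d\<^sup>2 dvd n) \<longrightarrow> (n \<in> {n. 0 < n \<and> omega_in J n = m} \<longleftrightarrow> n \<in> B))"
    by blast
qed

section \<open>Elementary symmetric sums of negative powers\<close>

text \<open>
  Removing the largest element \<open>b\<close> from a set of \<open>m\<close> positive integers removes a factor of at
  least \<open>m\<close>, because the set lies in \<open>{1..b}\<close>.
\<close>

lemma fact_card_le_prod: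
  assumes "finite A" "0 \<notin> A"
  shows "fact (card A) \<le> \<Prod>(A::nat set)"
  using assms
proof (induction A rule: finite_linorder_max_induct)
  case (insert b A)
  have "insert b A \<subseteq> {0<..b}" 
  proof
    fix k assume "k \<in> insert b A"
    then have "k \<noteq> 0" "k \<le> b" using insert by (metis, auto)
    then show "k \<in> {0<..b}" by simp
  qed
  then have "card (insert b A) \<le> card {0<..b}" by (intro card_mono) auto
  moreover have "b \<notin> A" using insert by auto
  ultimately have "fact (card (insert b A)) \<le> b * \<Prod>A"
    using insert by (simp del: mult_Suc add: fact_Suc mult_le_mono)
  then show ?case using insert \<open>b \<notin> A\<close> by simp
qed simp

text \<open>
  The symmetric sum is the coefficient of \<open>t ^ m\<close> in the product of the \<open>1 + t a k\<close>. All
  coefficients are nonnegative, so \<open>t ^ m\<close> times it is at most the value of the product at \<open>t\<close>, and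
  \<open>1 + x \<le> exp x\<close>.
\<close>

lemma symmetric_sum_le:
  fixes a :: "'a \<Rightarrow> real"
  assumes "finite S" "\<And>k. k \<in> S \<Longrightarrow> 0 \<le> a k" "0 < t"
  shows "(\<Sum>A | A \<subseteq> S \<and> card A = m. \<Prod>k\<in>A. a k) \<le> exp (t * (\<Sum>k\<in>S. a k)) / t ^ m"
proof -
  have "t ^ m * (\<Sum>A | A \<subseteq> S \<and> card A = m. \<Prod>k\<in>A. a k)
      = (\<Sum>A | A \<subseteq> S \<and> card A = m. \<Prod>k\<in>A. t * a k)"
    by (auto simp: sum_distrib_left prod.distrib intro!: sum.cong)
  also have "\<dots> \<le> (\<Sum>A\<in>Pow S. \<Prod>k\<in>A. t * a k)"
    using assms by (intro sum_mono2) (auto intro!: prod_nonneg)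
  also have "\<dots> = (\<Prod>k\<in>S. t * a k + 1)"
    by (simp add: prod_add[OF assms(1)])
  also have "\<dots> \<le> (\<Prod>k\<in>S. exp (t * a k))"
    using assms by (intro prod_mono) (auto simp: add.commute exp_ge_add_one_self)
  also have "\<dots> = exp (t * (\<Sum>k\<in>S. a k))"
    by (simp add: exp_sum[OF assms(1)] sum_distrib_left)
  finally show ?thesis using assms(3) by (simp add: field_simps)
qed

text \<open>The quotient \<open>m ^ m / m!\<close> is a single term of the exponential series at \<open>m\<close>.\<close>

lemma power_self_le_exp_mult_fact: "real m ^ m \<le> exp (real m) * fact m"
proof -
  have "real m ^ m / fact m \<le> exp (real m)"
    using sum_le_suminf[OF summable_exp, of "{m}" "real m"]
    by (simp add: exp_def scaleR_conv_of_real field_simps)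
  then show ?thesis by (simp add: field_simps)
qed

text \<open>
  Either estimate alone saves too little: \<open>symmetric_sum_le\<close> by itself only yields
  \<open>m\<close> to the power \<open>-m\<close>, and pulling out \<open>m!\<close> with the whole exponent leaves a sum that grows
  with \<open>N\<close>. The exponent is therefore shared between the two. The choice \<open>t = m\<close> is optimal up to
  factors exponential in \<open>m\<close>.
\<close>

lemma symmetric_powr_sum_le:
  assumes "0 \<le> a" "0 < m"
  shows "(\<Sum>A | A \<subseteq> {1..N} \<and> card A = m. \<Prod>k\<in>A. real k powr - (a + b))
    \<le> fact m powr - a * (exp (real m * (\<Sum>k=1..N. real k powr - b)) / real m ^ m)"
proof -
  have "(\<Sum>A | A \<subseteq> {1..N} \<and> card A = m. \<Prod>k\<in>A. real k powr - (a + b))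
      \<le> (\<Sum>A | A \<subseteq> {1..N} \<and> card A = m. fact m powr - a * (\<Prod>k\<in>A. real k powr - b))"
  proof (rule sum_mono)
    fix A assume "A \<in> {A. A \<subseteq> {1..N} \<and> card A = m}"
    then have A: "finite A" "0 \<notin> A" "card A = m"
      by (auto intro: finite_subset)
    have "(fact m :: real) = real (fact m)" by simp
    also have "\<dots> \<le> real (\<Prod>A)"
      using fact_card_le_prod[OF A(1,2)] A(3) by (simp only: of_nat_le_iff)
    finally have "fact m \<le> (\<Prod>k\<in>A. real k)" by simp
    then have "(\<Prod>k\<in>A. real k) powr - a \<le> fact m powr - a"
      using assms(1) by (intro powr_mono2') auto
    moreover have "(\<Prod>k\<in>A. real k powr - (a + b))
        = (\<Prod>k\<in>A. real k) powr - a * (\<Prod>k\<in>A. real k powr - b)"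
    proof -
      have "(\<Prod>k\<in>A. real k powr - (a + b)) = (\<Prod>k\<in>A. real k powr - a * real k powr - b)"
        by (simp flip: powr_add)
      then show ?thesis by (simp add: prod.distrib prod_powr_distrib)
    qed
    ultimately show "(\<Prod>k\<in>A. real k powr - (a + b)) \<le> fact m powr - a * (\<Prod>k\<in>A. real k powr - b)"
      by (simp add: mult_right_mono prod_nonneg)
  qed
  also have "\<dots> = fact m powr - a * (\<Sum>A | A \<subseteq> {1..N} \<and> card A = m. \<Prod>k\<in>A. real k powr - b)"
    by (simp add: sum_distrib_left)
  also have "\<dots> \<le> fact m powr - a * (exp (real m * (\<Sum>k=1..N. real k powr - b)) / real m ^ m)"
    using assms(2) by (intro mult_left_mono symmetric_sum_le) auto
  finally show ?thesis .
qed

section \<open>Bounding the density by a symmetric sum\<close>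

lemma prod_primes_power_dvd:
  fixes n :: nat
  assumes "finite A" "\<And>p. p \<in> A \<Longrightarrow> prime p \<and> p ^ s dvd n"
  shows "\<Prod>A ^ s dvd n"
  using assms
proof (induction A rule: finite_induct)
  case (insert p A)
  have "coprime p q" if "q \<in> A" for q
    using insert that by (intro primes_coprime) auto
  then have "coprime (p ^ s) (\<Prod>A ^ s)"
    by (simp add: prod_coprime_right)
  then show ?case
    using insert by (simp add: power_mult_distrib divides_mult)
qed simp

text \<open>
  Every counted \<open>n\<close> is a multiple of \<open>\<Prod>A ^ s\<close>, where \<open>A\<close> is the set of its \<open>m\<close> primes with
  multiplicity in \<open>J\<close>. Letting \<open>A\<close> range over all \<open>m\<close>-element sets of positive integers, instead of
  primes, does not affect the leading exponent in \<open>m\<close>.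
\<close>

lemma count_upto_omega_in_le:
  assumes J: "J \<subseteq> {s..}" and s: "0 < s"
  shows "real (count_upto {n. 0 < n \<and> omega_in J n = m} N)
    \<le> real N * (\<Sum>A | A \<subseteq> {1..N} \<and> card A = m. \<Prod>k\<in>A. real k powr - real s)"
proof -
  let ?I = "{A. A \<subseteq> {1..N} \<and> card A = m}"
  have fin: "finite A" "0 \<notin> A" if "A \<in> ?I" for A
    using that by (auto intro: finite_subset)
  have "real (count_upto {n. 0 < n \<and> omega_in J n = m} N)
      \<le> real N * (\<Sum>A\<in>?I. 1 / real (\<Prod>A ^ s))"
  proof (rule count_upto_UN_multiples_le)
    show "finite ?I" by simp
    show "0 < \<Prod>A ^ s" if "A \<in> ?I" for A
      using fin[OF that] by (metis gr0I power_eq_0_iff prod_zero_iff)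
    show "{n. 0 < n \<and> omega_in J n = m} \<inter> {0<..N} \<subseteq> (\<Union>A\<in>?I. {n. \<Prod>A ^ s dvd n})"
    proof
      fix n assume "n \<in> {n. 0 < n \<and> omega_in J n = m} \<inter> {0<..N}"
      then have n: "0 < n" "n \<le> N" "omega_in J n = m" by auto
      define A where "A = {p. prime p \<and> multiplicity p n \<in> J}"
      have J0: "0 \<notin> J" using J s by auto
      have "p \<in> {1..N}" if "p \<in> A" for p
      proof -
        have "prime p" "p dvd n"
          using that prime_dvd_if_multiplicity[OF J0] by (auto simp: A_def)
        then show ?thesis
          using n prime_gt_0_nat[of p] dvd_imp_le[of p n] by auto
      qed
      then have "A \<in> ?I"
        using n(3) by (auto simp: A_def omega_in_def)
      moreover have "\<Prod>A ^ s dvd n"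
      proof (rule prod_primes_power_dvd)
        show "finite A" by (rule fin(1)[OF \<open>A \<in> ?I\<close>])
        show "prime p \<and> p ^ s dvd n" if "p \<in> A" for p
          using that J by (auto simp: A_def intro!: multiplicity_dvd')
      qed
      ultimately show "n \<in> (\<Union>A\<in>?I. {n. \<Prod>A ^ s dvd n})" by blast
    qed
  qed
  also have "(\<Sum>A\<in>?I. 1 / real (\<Prod>A ^ s)) = (\<Sum>A\<in>?I. \<Prod>k\<in>A. real k powr - real s)"
  proof (rule sum.cong[OF refl])
    fix A assume A: "A \<in> ?I"
    have "(\<Prod>k\<in>A. real k powr - real s) = (\<Prod>k\<in>A. 1 / real k ^ s)"
    proof (rule prod.cong[OF refl])
      fix k assume "k \<in> A"
      then have "0 < k" using fin(2)[OF A] by (cases k) auto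
      then show "real k powr - real s = 1 / real k ^ s"
        by (simp add: powr_minus_divide powr_realpow)
    qed
    then show "1 / real (\<Prod>A ^ s) = (\<Prod>k\<in>A. real k powr - real s)"
      by (simp add: prod_dividef prod_power_distrib)
  qed
  finally show ?thesis .
qed

lemma natural_density_omega_in_le:
  assumes J: "J \<subseteq> {s..}" and s: "2 \<le> s" and "0 < (\<epsilon>::real)"
  shows "\<forall>\<^sub>F m in sequentially.
    natural_density {n. 0 < n \<and> omega_in J n = m} \<le> real m powr - ((real s - \<epsilon>) * real m)"
proof -
  \<comment> \<open>One \<open>\<delta>\<close> is spent on the convergence of the series \<open>Z\<close>, another on absorbing the exponential
    factors; \<open>\<delta> \<le> 1\<close> and \<open>s \<ge> 2\<close> keep \<open>a\<close> nonnegative.\<close>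
  define \<delta> where "\<delta> = min (\<epsilon> / 2) 1"
  define a where "a = real s - 1 - \<delta>"
  define b where "b = 1 + \<delta>"
  define Z where "Z = (\<Sum>k. real k powr - b)"
  have \<delta>: "0 < \<delta>" "2 * \<delta> \<le> \<epsilon>" "0 \<le> a" "a + b = real s"
    using assms by (auto simp: \<delta>_def a_def b_def)
  have Z: "(\<Sum>k=1..N. real k powr - b) \<le> Z" for N
    unfolding Z_def using \<delta>(1)
    by (intro sum_le_suminf) (auto simp: summable_real_powr_iff b_def)
  have "filterlim (\<lambda>m. \<delta> * ln (real m)) at_top sequentially"
    using \<delta>(1) by (intro filterlim_tendsto_pos_mult_at_top[OF tendsto_const]
      filterlim_compose[OF ln_at_top filterlim_real_sequentially])
  then have "\<forall>\<^sub>F m in sequentially. a + Z \<le> \<delta> * ln (real m)"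
    by (simp add: filterlim_at_top)
  with eventually_gt_at_top[of 0] show ?thesis
  proof eventually_elim
    case (elim m)
    define L where "L = ln (real m)"
    have L: "0 \<le> L" "real m = exp L" using elim by (auto simp: L_def)
    let ?A = "{n. 0 < n \<and> omega_in J n = m}"
    obtain e where e: "(\<lambda>N. real (count_upto ?A N) / real N) \<longlonglongrightarrow> e"
      using omega_in_convergent_density[of J m] J s unfolding convergent_def
      by (meson atLeast_subset_iff subset_trans)
    have "fact m powr - a \<le> exp (real m * L - real m) powr - a"
    proof (rule powr_mono2')
      have "exp (real m * L - real m) = real m ^ m / exp (real m)"
        by (simp add: exp_diff exp_of_nat_mult flip: L(2))
      also have "\<dots> \<le> fact m"
        using power_self_le_exp_mult_fact[of m] by (simp add: field_simps)
      finally show "exp (real m * L - real m) \<le> fact m" .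
    qed (use \<delta> in auto)
    then have fact_le: "fact m powr - a \<le> exp (- a * (real m * L - real m))"
      by (simp add: powr_def)
    have "real (count_upto ?A N) / real N \<le> real m powr - ((real s - \<epsilon>) * real m)" for N
    proof -
      have "real (count_upto ?A N)
          \<le> real N * (\<Sum>A | A \<subseteq> {1..N} \<and> card A = m. \<Prod>k\<in>A. real k powr - real s)"
        using J s by (intro count_upto_omega_in_le) auto
      then have "real (count_upto ?A N) / real N
          \<le> (\<Sum>A | A \<subseteq> {1..N} \<and> card A = m. \<Prod>k\<in>A. real k powr - (a + b))"
        unfolding \<delta>(4) by (cases "N = 0") (auto simp: field_simps intro!: sum_nonneg prod_nonneg)
      also have "\<dots> \<le> fact m powr - a * (exp (real m * (\<Sum>k=1..N. real k powr - b)) / real m ^ m)"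
        using \<delta> elim by (intro symmetric_powr_sum_le) auto
      also have "\<dots> \<le> exp (- a * (real m * L - real m)) * (exp (real m * Z) / real m ^ m)"
        by (intro mult_mono divide_right_mono fact_le) (auto intro!: mult_left_mono Z[simplified])
      also have "\<dots> = exp (real m * (a + Z - (a + 1) * L))"
      proof -
        have "real m ^ m = exp (real m * L)" by (simp add: exp_of_nat_mult flip: L(2))
        then show ?thesis
          by (simp add: algebra_simps flip: exp_add exp_diff)
      qed
      also have "\<dots> \<le> exp (real m * (- ((real s - \<epsilon>) * L)))"
      proof -
        have "a + Z \<le> (\<epsilon> - \<delta>) * L"
          using elim mult_right_mono[OF _ L(1), of \<delta> "\<epsilon> - \<delta>"] \<delta>(2) by (simp add: L_def)
        then have "a + Z - (a + 1) * L \<le> - ((real s - \<epsilon>) * L)"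
          by (simp add: a_def algebra_simps)
        then show ?thesis by (simp only: exp_le_cancel_iff mult_left_mono of_nat_0_le_iff)
      qed
      also have "\<dots> = real m powr - ((real s - \<epsilon>) * real m)"
        using elim by (simp add: powr_def L_def algebra_simps)
      finally show ?thesis .
    qed
    then have "e \<le> real m powr - ((real s - \<epsilon>) * real m)"
      by (intro tendsto_upperbound[OF e]) auto
    then show ?case using natural_density_eqI[OF e] by simp
  qed
qed

theorem corollary14:
  shows "\<forall>\<epsilon>::real. \<epsilon> > 0 \<longrightarrow> (\<exists>m0::nat. \<forall>m::nat. m \<ge> m0 \<longrightarrow>
    e_S m \<le> real m powr (- ((2 - \<epsilon>) * real m)) \<and>
    e_E m \<le> real m powr (- ((2 - \<epsilon>) * real m)) \<and>
    e_O m \<le> real m powr (- ((3 - \<epsilon>) * real m)))"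
proof (intro allI impI)
  fix \<epsilon> :: real assume "\<epsilon> > 0"
  let ?D = "\<lambda>J m. natural_density {n. 0 < n \<and> omega_in J n = m}"
  have "e_S m = ?D {j. j \<ge> 2} m" for m
    unfolding e_S_def omega_S_def by (simp add: infsum_omega_exact cong: conj_cong)
  moreover have "e_E m = ?D {j. j \<ge> 2 \<and> even j} m" for m
    unfolding e_E_def omega_E_def by (simp add: infsum_omega_exact cong: conj_cong)
  moreover have "e_O m = ?D {j. j \<ge> 3 \<and> odd j} m" for m
    unfolding e_O_def omega_O_def by (simp add: infsum_omega_exact cong: conj_cong)
  moreover have "\<forall>\<^sub>F m in sequentially.
      ?D {j. j \<ge> 2} m \<le> real m powr - ((2 - \<epsilon>) * real m) \<and>
      ?D {j. j \<ge> 2 \<and> even j} m \<le> real m powr - ((2 - \<epsilon>) * real m) \<and>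
      ?D {j. j \<ge> 3 \<and> odd j} m \<le> real m powr - ((3 - \<epsilon>) * real m)"
    using natural_density_omega_in_le[of "{j. j \<ge> 2}" 2 \<epsilon>]
      natural_density_omega_in_le[of "{j. j \<ge> 2 \<and> even j}" 2 \<epsilon>]
      natural_density_omega_in_le[of "{j. j \<ge> 3 \<and> odd j}" 3 \<epsilon>] \<open>\<epsilon> > 0\<close>
    by (intro eventually_conj) auto
  ultimately show "\<exists>m0. \<forall>m\<ge>m0.
      e_S m \<le> real m powr - ((2 - \<epsilon>) * real m) \<and>
      e_E m \<le> real m powr - ((2 - \<epsilon>) * real m) \<and>
      e_O m \<le> real m powr - ((3 - \<epsilon>) * real m)"
    by (simp only: eventually_sequentially)
qed

end
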